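(* Let $(X,d)$ be a metric space and let $g:X\to X$. The following statements hold. (a) Suppose there exist $k\in(0,1)$ and a metric-preserving function $f:[0,\infty)\to[0,\infty)$ such that (i) for each $x\in X$ there exists $\varepsilon>0$ such that for every $u\in X$, $d(x,u)<\varepsilon$ implies $f(d(g(x),g(u)))\le k\,d(x,u)$, and (ii) $f'(0)>k$. Suppose in addition that $X$ is complete and rectifiably pathwise connected. Then $g$ has a unique fixed point $x_0$, and $\lim_{n\to\infty}g^n(x)=x_0$ for each $x\in X$. (b) Suppose there exist $k\in(0,1)$ and a metric-preserving function $f:[0,\infty)\to[0,\infty)$ such that (i) for each $x\in X$ there exists $\varepsilon>0$ such that for every $u\in X$, $d(x,u)<\varepsilon$ implies $f(d(g(x),g(u)))\le k\,d(x,u)$, and (ii$'$) there exists $c\in(0,1)$ such that $f(ct)\ge kt$ for all $t>0$ sufficiently small. Suppose in addition that $X$ is complete and rectifiably pathwise connected. Then $g$ has a unique fixed point $x_0$, and $\lim_{n\to\infty}g^n(x)=x_0$ for each $x\in X$.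
   Context: A function $f:[0,\infty)\to[0,\infty)$ is metric-preserving if for every metric space $(Y,\rho)$, the composition $f\circ\rho$ is a metric on $Y$. For a metric-preserving $f$, $f'(0)$ denotes the one-sided derivative $\lim_{y\to0^+}\frac{f(y)-f(0)}{y}=\lim_{y\to0^+}\frac{f(y)}{y}$ (note $f(0)=0$); it is a known fact that this limit always exists in $\mathbb R\cup\{+\infty\}$, and the value $+\infty$ is allowed. A path in $X$ is a continuous map $\gamma:[a,b]\to X$; its length is the supremum of $\sum_{i=1}^N d(\gamma(y_{i-1}),\gamma(y_i))$ over all finite partitions $a=y_0\le y_1\le\cdots\le y_N=b$; it is rectifiable if its length is finite. $X$ is rectifiably pathwise connected if every two points of $X$ can be joined by a rectifiable path. $g^n$ denotes the $n$-th iterate of $g$. *)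

theory Defs
  imports "HOL-Analysis.Analysis"
begin

section \<open>Metric-preserving functions\<close>

text \<open>
  A function on \<open>[0,\<infinity>)\<close> is a function on the reals of which only the values on
  \<open>{0..}\<close> matter. HOL cannot quantify over the metric spaces on all types inside a formula, so the
  definition quantifies over the metric spaces carried by arbitrary sets of reals. Lemma
  \<open>metric_preserving_Metric_space\<close> below shows that this gives the property for the
  metric spaces on every type.
\<close>

definition metric_preserving :: "(real \<Rightarrow> real) \<Rightarrow> bool" where
  "metric_preserving f \<longleftrightarrow>
     f \<in> {0..} \<rightarrow> {0..} \<and>
     (\<forall>(Y :: real set) \<rho>. Metric_space Y \<rho> \<longrightarrow> Metric_space Y (\<lambda>x y. f (\<rho> x y)))"

lemma metric_preserving_Metric_space:
  fixes Y :: "'b set"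
  assumes f: "metric_preserving f" and Y: "Metric_space Y \<rho>"
  shows "Metric_space Y (\<lambda>x y. f (\<rho> x y))"
proof -
  interpret Metric_space Y \<rho> by (fact Y)
  have transfer: "\<exists>(e :: 'b \<Rightarrow> real) h. (\<forall>x\<in>S. h (e x) = x) \<and>
      Metric_space (e ` S) (\<lambda>r s. f (\<rho> (h r) (h s)))" if "finite S" "S \<subseteq> Y" for S
  proof -
    obtain e0 :: "'b \<Rightarrow> nat" where "inj_on e0 S"
      using finite_imp_inj_to_nat_seg[OF \<open>finite S\<close>] by blast
    define e where "e = real \<circ> e0"
    have e: "inj_on e S"
      using \<open>inj_on e0 S\<close> by (auto simp: e_def inj_on_def)
    define h where "h = inv_into S e"
    have h: "h (e x) = x" if "x \<in> S" for x
      using e that by (simp add: h_def)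
    have "Metric_space (e ` S) (\<lambda>r s. \<rho> (h r) (h s))"
    proof
      show "\<rho> (h x) (h y) = 0 \<longleftrightarrow> x = y" if "x \<in> e ` S" "y \<in> e ` S" for x y
        using that h \<open>S \<subseteq> Y\<close> by (metis imageE subsetD zero)
      show "\<rho> (h x) (h z) \<le> \<rho> (h x) (h y) + \<rho> (h y) (h z)"
        if "x \<in> e ` S" "y \<in> e ` S" "z \<in> e ` S" for x y z
        using that h \<open>S \<subseteq> Y\<close> by (metis imageE subsetD triangle)
    qed (simp_all add: commute)
    then have "Metric_space (e ` S) (\<lambda>r s. f (\<rho> (h r) (h s)))"
      using f by (simp add: metric_preserving_def)
    with h show ?thesis by blast
  qed
  show ?thesis
  proof
    show "0 \<le> f (\<rho> x y)" for x y
      using f by (auto simp: metric_preserving_def Pi_iff)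
    show "f (\<rho> x y) = f (\<rho> y x)" for x y
      by (simp add: commute)
    show "f (\<rho> x y) = 0 \<longleftrightarrow> x = y" if xy: "x \<in> Y" "y \<in> Y" for x y
    proof -
      obtain e :: "'b \<Rightarrow> real" and h where eh: "\<forall>u\<in>{x, y}. h (e u) = u"
        and M: "Metric_space (e ` {x, y}) (\<lambda>r s. f (\<rho> (h r) (h s)))"
        using transfer[of "{x, y}"] xy by auto
      show ?thesis
        using Metric_space.zero[OF M, of "e x" "e y"] eh by (metis image_eqI insertCI)
    qed
    show "f (\<rho> x z) \<le> f (\<rho> x y) + f (\<rho> y z)" if xyz: "x \<in> Y" "y \<in> Y" "z \<in> Y" for x y z
    proof -
      obtain e :: "'b \<Rightarrow> real" and h where eh: "\<forall>u\<in>{x, y, z}. h (e u) = u"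
        and M: "Metric_space (e ` {x, y, z}) (\<lambda>r s. f (\<rho> (h r) (h s)))"
        using transfer[of "{x, y, z}"] xyz by auto
      show ?thesis
        using Metric_space.triangle[OF M, of "e x" "e y" "e z"] eh by simp
    qed
  qed
qed

text \<open>
  The one-sided derivative at 0, with \<open>\<infinity>\<close> as an admissible value. \<open>Lim\<close> is
  unspecified when there is no limit, but for metric-preserving functions the limit exists, see
  \<open>metric_preserving_right_deriv_0\<close>.
\<close>

definition right_deriv_0 :: "(real \<Rightarrow> real) \<Rightarrow> ereal" where
  "right_deriv_0 f = Lim (at_right 0) (\<lambda>y. ereal ((f y - f 0) / y))"

lemma metric_preserving_0:
  assumes "metric_preserving f"
  shows "f 0 = 0"
proof -
  have "Metric_space UNIV (\<lambda>x y. f (dist x (y::real)))"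
    using metric_preserving_Metric_space[OF assms Met_TC.Metric_space_axioms] .
  from Metric_space.zero[OF this, of 0 0] show ?thesis by simp
qed

lemma metric_preserving_triangle:
  assumes f: "metric_preserving f" and "0 < a" "0 < b" "0 < c" "a \<le> b + c" "b \<le> a + c" "c \<le> a + b"
  shows "f a \<le> f b + f c"
proof -
  define \<rho> :: "nat \<Rightarrow> nat \<Rightarrow> real"
    where "\<rho> i j = (if i = j then 0 else if i + j = 1 then a else if i + j = 2 then b else c)" for i j
  have "Metric_space {0, 1, 2} \<rho>"
    by standard (use assms(2-) in \<open>auto simp: \<rho>_def split: if_splits\<close>)
  from Metric_space.triangle[OF metric_preserving_Metric_space[OF f this], of 0 2 1]
  show ?thesis by (simp add: \<rho>_def)
qed

lemma metric_preserving_mult_le: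
  assumes f: "metric_preserving f" and "0 < h"
  shows "f (real n * h) \<le> real n * f h"
proof (induction n)
  case 0
  then show ?case using metric_preserving_0[OF f] by simp
next
  case (Suc n)
  show ?case
  proof (cases "n = 0")
    case False
    then have "f (real (Suc n) * h) \<le> f (real n * h) + f h"
      using \<open>0 < h\<close> by (intro metric_preserving_triangle[OF f]) (auto simp: algebra_simps add_pos_pos)
    with Suc show ?thesis by (simp add: algebra_simps)
  qed simp
qed

lemma metric_preserving_difference_quotient:
  assumes f: "metric_preserving f" and "0 < a" "0 < h"
  shows "f a / (a + 2 * h) \<le> f h / h"
proof -
  have fh: "0 \<le> f h"
    using f \<open>0 < h\<close> by (auto simp: metric_preserving_def Pi_iff)
  define n where "n = nat \<lceil>a / h\<rceil>"
  have "n > 0" and lb: "a / h \<le> real n" and ub: "real n < a / h + 1"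
    using assms(2,3) by (auto simp: n_def) linarith+
  have "f a \<le> f (real n * h) + f h"
  proof (rule metric_preserving_triangle[OF f])
    show "real n * h \<le> a + h"
      using ub \<open>0 < h\<close> by (simp add: field_simps)
    show "a \<le> real n * h + h"
      using lb \<open>0 < h\<close> by (simp add: field_simps)
    show "h \<le> a + real n * h"
      using \<open>n > 0\<close> \<open>0 < h\<close> \<open>0 < a\<close> by (cases n) (auto simp: algebra_simps)
  qed (use assms(2,3) \<open>n > 0\<close> in auto)
  also have "\<dots> \<le> (real n + 1) * f h"
    using metric_preserving_mult_le[OF f \<open>0 < h\<close>, of n] by (simp add: algebra_simps)
  also have "\<dots> \<le> (a / h + 2) * f h"
    using ub fh by (intro mult_right_mono) auto
  also have "\<dots> = f h / h * (a + 2 * h)"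
    using \<open>0 < h\<close> by (simp add: field_simps)
  finally show ?thesis
    using assms(2,3) by (simp add: pos_divide_le_eq)
qed

lemma metric_preserving_right_deriv_0:
  assumes f: "metric_preserving f"
  shows "((\<lambda>y. ereal ((f y - f 0) / y)) \<longlongrightarrow> right_deriv_0 f) (at_right 0)"
proof -
  define S where "S = (SUP a\<in>{0<..}. ereal (f a / a))"
  have "((\<lambda>y. ereal (f y / y)) \<longlongrightarrow> S) (at_right 0)"
  proof (rule order_tendstoI)
    fix s assume "s < S"
    then obtain a where a: "0 < a" "s < ereal (f a / a)"
      unfolding S_def less_SUP_iff by auto
    have "((\<lambda>h. f a / (a + 2 * h)) \<longlongrightarrow> f a / (a + 2 * 0)) (at_right 0)"
      using a by (intro tendsto_intros) auto
    then have "((\<lambda>h. ereal (f a / (a + 2 * h))) \<longlongrightarrow> ereal (f a / a)) (at_right 0)"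
      by simp
    then have "\<forall>\<^sub>F h in at_right 0. s < ereal (f a / (a + 2 * h))"
      using a(2) by (rule order_tendstoD)
    moreover have "\<forall>\<^sub>F h in at_right (0::real). 0 < h"
      by (rule eventually_at_right_less)
    ultimately show "\<forall>\<^sub>F h in at_right 0. s < ereal (f h / h)"
      by eventually_elim
        (use metric_preserving_difference_quotient[OF f a(1)] in \<open>force elim: less_le_trans\<close>)
  next
    fix s assume "S < s"
    have "\<forall>\<^sub>F h in at_right (0::real). 0 < h"
      by (rule eventually_at_right_less)
    then show "\<forall>\<^sub>F h in at_right 0. ereal (f h / h) < s"
    proof eventually_elim
      case (elim h)
      then have "ereal (f h / h) \<le> S"
        unfolding S_def by (intro SUP_upper) auto
      with \<open>S < s\<close> show ?case by (rule le_less_trans[rotated])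
    qed
  qed
  then have "((\<lambda>y. ereal ((f y - f 0) / y)) \<longlongrightarrow> S) (at_right 0)"
    by (simp add: metric_preserving_0[OF f])
  moreover from this have "right_deriv_0 f = S"
    unfolding right_deriv_0_def by (intro tendsto_Lim) auto
  ultimately show ?thesis by simp
qed

section \<open>Rectifiable paths\<close>

definition path_length :: "real \<Rightarrow> real \<Rightarrow> (real \<Rightarrow> 'a::metric_space) \<Rightarrow> ereal" where
  "path_length a b \<gamma> =
     (SUP (N, y) \<in> {(N :: nat, y :: nat \<Rightarrow> real). y 0 = a \<and> y N = b \<and> (\<forall>i<N. y i \<le> y (Suc i))}.
        ereal (\<Sum>i = 1..N. dist (\<gamma> (y (i - 1))) (\<gamma> (y i))))"

definition rectifiable_path :: "real \<Rightarrow> real \<Rightarrow> (real \<Rightarrow> 'a::metric_space) \<Rightarrow> bool" where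
  "rectifiable_path a b \<gamma> \<longleftrightarrow> a \<le> b \<and> continuous_on {a..b} \<gamma> \<and> path_length a b \<gamma> < \<infinity>"

definition rectifiably_path_connected :: "'a::metric_space set \<Rightarrow> bool" where
  "rectifiably_path_connected S \<longleftrightarrow>
     (\<forall>p\<in>S. \<forall>q\<in>S. \<exists>a b \<gamma>. rectifiable_path a b \<gamma> \<and> \<gamma> ` {a..b} \<subseteq> S \<and> \<gamma> a = p \<and> \<gamma> b = q)"

end

theory Submission
  imports Defs
begin

text \<open>
  Each hypothesis on \<open>f\<close> near 0 says that \<open>f t \<ge> L * t\<close> for small \<open>t\<close> with some \<open>L > k\<close>. Since a
  metric-preserving \<open>f\<close> takes small values only near 0, every point \<open>x\<close> has a ball on which
  \<open>dist (g x) (g u) \<le> c * dist x u\<close>, where \<open>c = k / L < 1\<close>. This bound is only local and centred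
  at \<open>x\<close>, but it passes to iterates, and along a path of length \<open>l\<close> it sums up to
  \<open>dist (g\<^sup>n p) (g\<^sup>n q) \<le> c\<^sup>n * l\<close>. With \<open>q = g p\<close> this makes the orbits Cauchy, and with
  arbitrary \<open>q\<close> it makes all orbits have the same limit.
\<close>

section \<open>Maps with a Lipschitz bound centred at each point\<close>

text \<open>The radius depends on \<open>x\<close>, and one of the two points compared is always
  \<open>x\<close> itself. This is what hypothesis (i) can yield; two points near \<open>x\<close>
  are only compared by passing through \<open>x\<close>.\<close>

definition locally_radially_lipschitz :: "real \<Rightarrow> ('a::metric_space \<Rightarrow> 'b::metric_space) \<Rightarrow> bool" where
  "locally_radially_lipschitz C h \<longleftrightarrow>
     (\<forall>x. \<exists>\<epsilon>>0. \<forall>u. dist x u < \<epsilon> \<longrightarrow> dist (h x) (h u) \<le> C * dist x u)"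

lemma locally_radially_lipschitz_imp_isCont:
  assumes h: "locally_radially_lipschitz C h" and "0 \<le> C"
  shows "isCont h x"
proof -
  obtain \<epsilon> where \<epsilon>: "\<epsilon> > 0" "\<And>u. dist x u < \<epsilon> \<Longrightarrow> dist (h x) (h u) \<le> C * dist x u"
    using h by (auto simp: locally_radially_lipschitz_def)
  have "((\<lambda>u. C * dist u x) \<longlongrightarrow> C * dist x x) (at x)"
    by (intro tendsto_intros)
  then have lim: "((\<lambda>u. C * dist u x) \<longlongrightarrow> 0) (at x)"
    by simp
  have "\<forall>\<^sub>F u in at x. dist (h u) (h x) \<le> C * dist u x"
    using eventually_at_ball[OF \<epsilon>(1), of x UNIV]
    by eventually_elim (use \<epsilon>(2) in \<open>simp add: dist_commute\<close>)
  then have "((\<lambda>u. dist (h u) (h x)) \<longlongrightarrow> 0) (at x)"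
    by (intro tendsto_sandwich[OF _ _ tendsto_const lim]) simp_all
  then show ?thesis
    unfolding isCont_def by (rule iffD2[OF tendsto_dist_iff])
qed

text \<open>Continuity of the inner map at \<open>x\<close> brings a small ball around
  \<open>x\<close> into the ball around \<open>g x\<close> on which the bound for \<open>h\<close>
  is valid; there the two constants multiply.\<close>

lemma locally_radially_lipschitz_compose:
  assumes h: "locally_radially_lipschitz C h" and g: "locally_radially_lipschitz D g"
    and "0 \<le> C" "0 \<le> D"
  shows "locally_radially_lipschitz (C * D) (h \<circ> g)"
  unfolding locally_radially_lipschitz_def
proof
  fix x
  obtain e1 where e1: "e1 > 0" "\<And>v. dist (g x) v < e1 \<Longrightarrow> dist (h (g x)) (h v) \<le> C * dist (g x) v"
    using h by (auto simp: locally_radially_lipschitz_def)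
  obtain e2 where e2: "e2 > 0" "\<And>u. dist x u < e2 \<Longrightarrow> dist (g x) (g u) \<le> D * dist x u"
    using g by (auto simp: locally_radially_lipschitz_def)
  obtain e3 where e3: "e3 > 0" "\<And>u. dist x u < e3 \<Longrightarrow> dist (g x) (g u) < e1"
    using locally_radially_lipschitz_imp_isCont[OF g \<open>0 \<le> D\<close>, of x] e1(1)
    by (auto simp: continuous_at_eps_delta dist_commute)
  have "dist ((h \<circ> g) x) ((h \<circ> g) u) \<le> C * D * dist x u" if u: "dist x u < min e2 e3" for u
  proof -
    have "dist (h (g x)) (h (g u)) \<le> C * dist (g x) (g u)"
      using u by (intro e1(2) e3(2)) simp
    also have "\<dots> \<le> C * (D * dist x u)"
      using u \<open>0 \<le> C\<close> by (intro mult_left_mono e2(2)) auto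
    finally show ?thesis by (simp add: mult.assoc)
  qed
  then show "\<exists>\<epsilon>>0. \<forall>u. dist x u < \<epsilon> \<longrightarrow> dist ((h \<circ> g) x) ((h \<circ> g) u) \<le> C * D * dist x u"
    using e2(1) e3(1) by (intro exI[of _ "min e2 e3"]) auto
qed

lemma locally_radially_lipschitz_funpow:
  fixes g :: "'a::metric_space \<Rightarrow> 'a"
  assumes "locally_radially_lipschitz c g" and "0 \<le> c"
  shows "locally_radially_lipschitz (c ^ n) (g ^^ n)"
proof (induction n)
  case 0
  show ?case by (auto simp: locally_radially_lipschitz_def intro: zero_less_one)
next
  case (Suc n)
  then show ?case
    using locally_radially_lipschitz_compose[OF assms(1) Suc] assms(2) by (simp add: comp_def)
qed

section \<open>Partitions and the sums that approximate path length\<close>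

definition partition_of :: "real \<Rightarrow> real \<Rightarrow> nat \<Rightarrow> (nat \<Rightarrow> real) \<Rightarrow> bool" where
  "partition_of s t N y \<longleftrightarrow> y 0 = s \<and> y N = t \<and> (\<forall>i<N. y i \<le> y (Suc i))"

text \<open>These are the sums in \<open>path_length\<close> with the index shifted to start at 0,
  which suits concatenation.\<close>

definition variation_on :: "(real \<Rightarrow> 'a::metric_space) \<Rightarrow> nat \<Rightarrow> (nat \<Rightarrow> real) \<Rightarrow> real" where
  "variation_on \<gamma> N y = (\<Sum>i<N. dist (\<gamma> (y i)) (\<gamma> (y (Suc i))))"

lemma variation_on_le_path_length:
  assumes "partition_of a b N y"
  shows "ereal (variation_on \<gamma> N y) \<le> path_length a b \<gamma>"
proof -
  have "variation_on \<gamma> N y = (\<Sum>i = 1..N. dist (\<gamma> (y (i - 1))) (\<gamma> (y i)))"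
    unfolding variation_on_def by (simp add: sum.atLeast1_atMost_eq)
  moreover have "ereal (\<Sum>i = 1..N. dist (\<gamma> (y (i - 1))) (\<gamma> (y i))) \<le> path_length a b \<gamma>"
    unfolding path_length_def
    by (rule SUP_upper2[of "(N, y)"]) (use assms in \<open>auto simp: partition_of_def\<close>)
  ultimately show ?thesis by simp
qed

lemma partition_of_append:
  assumes y: "partition_of r s M y" and z: "partition_of s t N z"
  obtains w where "partition_of r t (M + N) w"
    and "variation_on \<gamma> (M + N) w = variation_on \<gamma> M y + variation_on \<gamma> N z"
proof
  define w where "w i = (if i \<le> M then y i else z (i - M))" for i
  have left: "w i = y i" if "i \<le> M" for i
    using that by (simp add: w_def)
  \<comment> \<open>At \<open>i = 0\<close> the definition of \<open>w\<close> selects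
    \<open>y M\<close> instead of \<open>z 0\<close>; both equal the common endpoint
    \<open>s\<close>.\<close>
  have right: "w (M + i) = z i" for i
    using y z by (simp add: w_def partition_of_def)
  have "w i \<le> w (Suc i)" if "i < M + N" for i
  proof (cases "i < M")
    case True
    with y show ?thesis by (simp add: left partition_of_def)
  next
    case False
    then obtain j where "i = M + j" by (metis le_add_diff_inverse not_less)
    with z that right[of j] right[of "Suc j"] show ?thesis
      by (simp add: partition_of_def)
  qed
  then show "partition_of r t (M + N) w"
    using y z left[of 0] right[of N] by (simp add: partition_of_def)
  have "variation_on \<gamma> (M + N) w =
      (\<Sum>i<M. dist (\<gamma> (w i)) (\<gamma> (w (Suc i)))) +
      (\<Sum>i<N. dist (\<gamma> (w (M + i))) (\<gamma> (w (Suc (M + i)))))"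
    unfolding variation_on_def by (induction N) auto
  also have "(\<Sum>i<M. dist (\<gamma> (w i)) (\<gamma> (w (Suc i)))) = variation_on \<gamma> M y"
    unfolding variation_on_def by (intro sum.cong) (auto simp: left)
  also have "(\<Sum>i<N. dist (\<gamma> (w (M + i))) (\<gamma> (w (Suc (M + i))))) = variation_on \<gamma> N z"
    unfolding variation_on_def
    using right right[of "Suc _"] by (intro sum.cong) auto
  finally show "variation_on \<gamma> (M + N) w = variation_on \<gamma> M y + variation_on \<gamma> N z" .
qed

section \<open>Estimates along paths\<close>

text \<open>Proof by bisection (\<open>Bolzano\<close>): the claim for subintervals is preserved
  when adjacent ones are joined, and every point has a scale below which it holds for the intervals
  containing that point. The partition depends on \<open>h\<close>, which is harmless since the path
  length bounds all partitions at once.\<close>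

lemma dist_le_mult_variation_on:
  assumes h: "locally_radially_lipschitz C h" and "a \<le> b" and \<gamma>: "continuous_on {a..b} \<gamma>"
  obtains N y where "partition_of a b N y"
    and "dist (h (\<gamma> a)) (h (\<gamma> b)) \<le> C * variation_on \<gamma> N y"
proof -
  define P where "P s t \<longleftrightarrow> (\<exists>N y. partition_of s t N y \<and>
    dist (h (\<gamma> s)) (h (\<gamma> t)) \<le> C * variation_on \<gamma> N y)" for s t
  \<comment> \<open>The local condition of \<open>Bolzano\<close> also concerns intervals that stick
    out of \<open>{a..b}\<close>, where nothing is known about \<open>\<gamma>\<close>; the guard
    makes the claim vacuous for them.\<close>
  define Q where "Q s t \<longleftrightarrow> (a \<le> s \<and> t \<le> b \<longrightarrow> P s t)" for s t
  from \<open>a \<le> b\<close> have "Q a b"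
  proof (rule Bolzano)
    fix r s t assume trans: "Q r s" "Q s t" "r \<le> s" "s \<le> t"
    show "Q r t"
      unfolding Q_def
    proof
      assume "a \<le> r \<and> t \<le> b"
      with trans have "P r s" "P s t" by (auto simp: Q_def)
      then obtain M y N z where y: "partition_of r s M y"
          "dist (h (\<gamma> r)) (h (\<gamma> s)) \<le> C * variation_on \<gamma> M y"
        and z: "partition_of s t N z" "dist (h (\<gamma> s)) (h (\<gamma> t)) \<le> C * variation_on \<gamma> N z"
        by (auto simp: P_def)
      obtain w where w: "partition_of r t (M + N) w"
        "variation_on \<gamma> (M + N) w = variation_on \<gamma> M y + variation_on \<gamma> N z"
        using partition_of_append[OF y(1) z(1)] .
      have "dist (h (\<gamma> r)) (h (\<gamma> t)) \<le> C * variation_on \<gamma> (M + N) w"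
        using y(2) z(2) dist_triangle[of "h (\<gamma> r)" "h (\<gamma> t)" "h (\<gamma> s)"]
        by (simp add: w(2) distrib_left)
      with w(1) show "P r t" unfolding P_def by blast
    qed
  next
    fix x assume x: "a \<le> x" "x \<le> b"
    obtain \<epsilon> where \<epsilon>: "\<epsilon> > 0" "\<And>u. dist (\<gamma> x) u < \<epsilon> \<Longrightarrow> dist (h (\<gamma> x)) (h u) \<le> C * dist (\<gamma> x) u"
      using h by (auto simp: locally_radially_lipschitz_def)
    obtain d where d: "d > 0" "\<And>s. s \<in> {a..b} \<Longrightarrow> dist s x < d \<Longrightarrow> dist (\<gamma> s) (\<gamma> x) < \<epsilon>"
      using \<gamma>[unfolded continuous_on_iff, rule_format, of x \<epsilon>] x \<epsilon>(1) by auto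
    have "P s t" if st: "s \<le> x" "x \<le> t" "t - s < d" "a \<le> s" "t \<le> b" for s t
    proof -
      have near: "dist (h (\<gamma> x)) (h (\<gamma> r)) \<le> C * dist (\<gamma> x) (\<gamma> r)" if "r \<in> {s, t}" for r
        using that st by (intro \<epsilon>(2)) (auto simp: dist_commute[of "\<gamma> x"] dist_real_def intro!: d(2))
      \<comment> \<open>Inserting \<open>x\<close> as a middle point gives both pieces an endpoint
        at the centre of the ball, so the radial bound applies to each.\<close>
      define y :: "nat \<Rightarrow> real" where "y i = (if i = 0 then s else if i = 1 then x else t)" for i
      have "partition_of s t 2 y"
        using st by (auto simp: partition_of_def y_def)
      moreover have "dist (h (\<gamma> s)) (h (\<gamma> t)) \<le> C * variation_on \<gamma> 2 y"
        using near[of s] near[of t] dist_triangle2[of "h (\<gamma> s)" "h (\<gamma> t)" "h (\<gamma> x)"]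
        by (simp add: variation_on_def y_def numeral_2_eq_2 distrib_left dist_commute)
      ultimately show ?thesis unfolding P_def by blast
    qed
    with d(1) show "\<exists>d>0. \<forall>s t. s \<le> x \<and> x \<le> t \<and> t - s < d \<longrightarrow> Q s t"
      unfolding Q_def by blast
  qed
  then obtain N y where "partition_of a b N y"
    "dist (h (\<gamma> a)) (h (\<gamma> b)) \<le> C * variation_on \<gamma> N y"
    unfolding P_def Q_def by blast
  then show ?thesis by (rule that)
qed

lemma locally_radially_lipschitz_dist_le_path_length:
  assumes h: "locally_radially_lipschitz C h" and "0 \<le> C" and \<gamma>: "rectifiable_path a b \<gamma>"
  shows "dist (h (\<gamma> a)) (h (\<gamma> b)) \<le> C * real_of_ereal (path_length a b \<gamma>)"
proof -
  have "a \<le> b" "continuous_on {a..b} \<gamma>"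
    using \<gamma> by (auto simp: rectifiable_path_def)
  from dist_le_mult_variation_on[OF h this] obtain N y where y: "partition_of a b N y"
    "dist (h (\<gamma> a)) (h (\<gamma> b)) \<le> C * variation_on \<gamma> N y" .
  \<comment> \<open>Since \<open>real_of_ereal\<close> sends infinite values to 0, both must be
    excluded: \<infinity> by rectifiability, and its negative because a real sum lies below the
    length.\<close>
  have "variation_on \<gamma> N y \<le> real_of_ereal (path_length a b \<gamma>)"
    using variation_on_le_path_length[OF y(1), of \<gamma>] \<gamma>
    by (cases "path_length a b \<gamma>") (auto simp: rectifiable_path_def)
  from mult_left_mono[OF this \<open>0 \<le> C\<close>] y(2) show ?thesis by linarith
qed

section \<open>The fixed point theorem for radial contractions\<close>

lemma locally_radially_lipschitz_fixed_point:
  fixes g :: "'a::metric_space \<Rightarrow> 'a"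
  assumes g: "locally_radially_lipschitz c g" and c: "0 \<le> c" "c < 1"
    and "complete (UNIV :: 'a set)" and conn: "rectifiably_path_connected (UNIV :: 'a set)"
  shows "\<exists>x0. g x0 = x0 \<and> (\<forall>z. g z = z \<longrightarrow> z = x0) \<and> (\<forall>x. (\<lambda>n. (g ^^ n) x) \<longlonglongrightarrow> x0)"
proof -
  \<comment> \<open>The path estimate is applied to the iterate \<open>g ^^ n\<close> along one
    fixed path from \<open>p\<close> to \<open>q\<close>, so \<open>l\<close> does not depend on
    \<open>n\<close>.\<close>
  have bound: "\<exists>l. \<forall>n. dist ((g ^^ n) p) ((g ^^ n) q) \<le> c ^ n * l" for p q
  proof -
    obtain a b \<gamma> where \<gamma>: "rectifiable_path a b \<gamma>" "\<gamma> a = p" "\<gamma> b = q"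
      using conn[unfolded rectifiably_path_connected_def, rule_format, OF UNIV_I UNIV_I, of p q]
      by (elim exE conjE)
    have "dist ((g ^^ n) p) ((g ^^ n) q) \<le> c ^ n * real_of_ereal (path_length a b \<gamma>)" for n
      using locally_radially_lipschitz_dist_le_path_length[OF
          locally_radially_lipschitz_funpow[OF g c(1)] zero_le_power[OF c(1)] \<gamma>(1)] \<gamma>(2,3)
      by simp
    then show ?thesis by blast
  qed
  have together: "(\<lambda>n. dist ((g ^^ n) p) ((g ^^ n) q)) \<longlonglongrightarrow> 0" for p q
  proof -
    obtain l where l: "\<And>n. dist ((g ^^ n) p) ((g ^^ n) q) \<le> c ^ n * l"
      using bound by blast
    have "(\<lambda>n. c ^ n * l) \<longlonglongrightarrow> 0 * l"
      using c by (intro tendsto_intros LIMSEQ_power_zero) auto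
    then have lim: "(\<lambda>n. c ^ n * l) \<longlonglongrightarrow> 0" by simp
    show ?thesis
      by (intro tendsto_sandwich[OF _ _ tendsto_const lim]) (simp_all add: l)
  qed
  \<comment> \<open>An arbitrary starting point; types are nonempty and the conclusion does not
    mention \<open>p\<close>.\<close>
  fix p :: 'a
  obtain l where l: "\<And>n. dist ((g ^^ n) p) ((g ^^ n) (g p)) \<le> c ^ n * l"
    using bound by blast
  have "Cauchy (\<lambda>n. (g ^^ n) p)"
  proof (unfold Cauchy_altdef, intro allI impI)
    fix e :: real assume "0 < e"
    have "l \<ge> 0"
      using order_trans[OF zero_le_dist l[of 0]] by simp
    \<comment> \<open>The partial geometric sum of the step bounds \<open>c ^ (m + j) * l\<close>
      for \<open>j < i\<close>, multiplied by \<open>1 - c\<close> to avoid division.\<close>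
    have le: "(1 - c) * dist ((g ^^ m) p) ((g ^^ (m + i)) p) \<le> c ^ m * l * (1 - c ^ i)" for m i
    proof (induction i)
      case (Suc i)
      have "dist ((g ^^ m) p) ((g ^^ (m + Suc i)) p)
          \<le> dist ((g ^^ m) p) ((g ^^ (m + i)) p) + c ^ (m + i) * l"
        using l[of "m + i"] dist_triangle[of "(g ^^ m) p" "(g ^^ (m + Suc i)) p" "(g ^^ (m + i)) p"]
        by (simp add: funpow_swap1[of g])
      from mult_left_mono[OF this, of "1 - c"] Suc c(2) show ?case
        by (simp add: algebra_simps power_add)
    qed simp
    have "(\<lambda>m. c ^ m * l) \<longlonglongrightarrow> 0 * l"
      using c by (intro tendsto_intros LIMSEQ_power_zero) auto
    then have "\<forall>\<^sub>F m in sequentially. c ^ m * l < (1 - c) * e"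
      using \<open>0 < e\<close> c(2) by (intro order_tendstoD) auto
    then obtain M where M: "\<And>m. m \<ge> M \<Longrightarrow> c ^ m * l < (1 - c) * e"
      unfolding eventually_sequentially by blast
    have "dist ((g ^^ m) p) ((g ^^ n) p) < e" if mn: "m \<ge> M" "n > m" for m n
    proof -
      obtain i where i: "n = m + i" using less_imp_add_positive[OF mn(2)] by blast
      have "c ^ m * l * (1 - c ^ i) \<le> c ^ m * l"
        using c(1) \<open>l \<ge> 0\<close> by (intro mult_left_le) auto
      with le[of m i] M[OF mn(1)]
      have "(1 - c) * dist ((g ^^ m) p) ((g ^^ n) p) < (1 - c) * e"
        unfolding i by linarith
      then show ?thesis using c(2) by simp
    qed
    then show "\<exists>M. \<forall>m\<ge>M. \<forall>n>m. dist ((g ^^ m) p) ((g ^^ n) p) < e" by blast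
  qed
  then obtain x0 where x0: "(\<lambda>n. (g ^^ n) p) \<longlonglongrightarrow> x0"
    using \<open>complete UNIV\<close>[unfolded complete_def, rule_format, of "\<lambda>n. (g ^^ n) p"] by auto
  have lim: "(\<lambda>n. (g ^^ n) q) \<longlonglongrightarrow> x0" for q
  proof -
    have "(\<lambda>n. dist ((g ^^ n) q) ((g ^^ n) p) + dist ((g ^^ n) p) x0) \<longlonglongrightarrow> 0 + 0"
      by (intro tendsto_add together iffD1[OF tendsto_dist_iff] x0)
    then have sum: "(\<lambda>n. dist ((g ^^ n) q) ((g ^^ n) p) + dist ((g ^^ n) p) x0) \<longlonglongrightarrow> 0"
      by simp
    show ?thesis
      unfolding tendsto_dist_iff[of _ x0]
      by (intro tendsto_sandwich[OF _ _ tendsto_const sum]) (simp_all add: dist_triangle)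
  qed
  have "(\<lambda>n. g ((g ^^ n) p)) \<longlonglongrightarrow> g x0"
    using isCont_tendsto_compose[OF locally_radially_lipschitz_imp_isCont[OF g c(1)] x0] .
  \<comment> \<open>Applying \<open>g\<close> shifts the orbit by one index, which leaves its limit
    unchanged.\<close>
  then have "(\<lambda>n. (g ^^ n) p) \<longlonglongrightarrow> g x0"
    by (subst filterlim_sequentially_Suc[symmetric]) simp
  with x0 have "g x0 = x0"
    using LIMSEQ_unique by blast
  moreover have "z = x0" if "g z = z" for z
  proof -
    have "(g ^^ n) z = z" for n
      using that by (induction n) auto
    with lim[of z] show ?thesis by (simp add: LIMSEQ_const_iff)
  qed
  ultimately show ?thesis using lim by blast
qed

section \<open>From metric-preserving functions to radial contractions\<close>

lemma metric_preserving_pos: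
  assumes f: "metric_preserving f" and "0 < t"
  shows "0 < f t"
proof -
  have M: "Metric_space UNIV (\<lambda>x y. f (dist x (y::real)))"
    using metric_preserving_Metric_space[OF f Met_TC.Metric_space_axioms] .
  show ?thesis
    using Metric_space.zero[OF M, of t 0] Metric_space.nonneg[OF M, of t 0] \<open>0 < t\<close>
    by (simp add: less_le)
qed

text \<open>The linear lower bound holds only for arguments below some \<open>\<delta>\<close>, so
  \<open>dist (g x) (g u) < \<delta>\<close> must come first. It follows because \<open>f\<close> is
  at least \<open>f \<delta> / 2 > 0\<close> on all arguments from \<open>\<delta>\<close>
  on.\<close>

lemma metric_preserving_locally_radially_lipschitz:
  fixes g :: "'a::metric_space \<Rightarrow> 'b::metric_space"
  assumes f: "metric_preserving f" and k: "0 < k"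
    and g: "\<forall>x. \<exists>\<epsilon>>0. \<forall>u. dist x u < \<epsilon> \<longrightarrow> f (dist (g x) (g u)) \<le> k * dist x u"
    and L: "0 < L" "\<forall>\<^sub>F t in at_right 0. L * t \<le> f t"
  shows "locally_radially_lipschitz (k / L) g"
  unfolding locally_radially_lipschitz_def
proof
  fix x
  obtain \<epsilon> where \<epsilon>: "\<epsilon> > 0" "\<And>u. dist x u < \<epsilon> \<Longrightarrow> f (dist (g x) (g u)) \<le> k * dist x u"
    using g by blast
  obtain \<delta> where \<delta>: "\<delta> > 0" "\<And>t. 0 < t \<Longrightarrow> t < \<delta> \<Longrightarrow> L * t \<le> f t"
    using L(2) unfolding eventually_at_right_field by auto
  \<comment> \<open>Chosen so that \<open>k * \<eta> = f \<delta> / 2\<close>.\<close>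
  define \<eta> where "\<eta> = f \<delta> / 2 / k"
  have \<eta>: "\<eta> > 0"
    using metric_preserving_pos[OF f \<delta>(1)] k by (simp add: \<eta>_def)
  have "dist (g x) (g u) \<le> k / L * dist x u" if u: "dist x u < min \<epsilon> \<eta>" for u
  proof (cases "g x = g u")
    case False
    have upper: "f (dist (g x) (g u)) \<le> k * dist x u"
      using \<epsilon> u by auto
    have "dist (g x) (g u) < \<delta>"
    proof (rule ccontr)
      assume "\<not> ?thesis"
      \<comment> \<open>An isosceles triangle with base \<open>\<delta>\<close> and two legs
        \<open>dist (g x) (g u)\<close> exists, as the legs are at least as long as the
        base.\<close>
      then have "f \<delta> \<le> f (dist (g x) (g u)) + f (dist (g x) (g u))"
        using False \<delta>(1) by (intro metric_preserving_triangle[OF f]) auto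
      with upper have "f \<delta> / 2 \<le> k * dist x u" by linarith
      also have "\<dots> < k * \<eta>"
        using u k by auto
      finally show False using k by (simp add: \<eta>_def)
    qed
    then have "L * dist (g x) (g u) \<le> k * dist x u"
      using \<delta>(2)[of "dist (g x) (g u)"] False upper by auto
    then show ?thesis using L(1) by (simp add: field_simps)
  qed (use k L(1) in auto)
  then show "\<exists>\<epsilon>>0. \<forall>u. dist x u < \<epsilon> \<longrightarrow> dist (g x) (g u) \<le> k / L * dist x u"
    using \<epsilon>(1) \<eta> by (intro exI[of _ "min \<epsilon> \<eta>"]) auto
qed

text \<open>The common core of (a) and (b), which differ only in how the slope \<open>L\<close> is
  found; \<open>k < L\<close> makes \<open>k / L\<close> a contraction constant.\<close>

lemma metric_preserving_contraction_fixed_point: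
  fixes g :: "'a::metric_space \<Rightarrow> 'a"
  assumes "metric_preserving f" and k: "0 < k"
    and "\<forall>x. \<exists>\<epsilon>>0. \<forall>u. dist x u < \<epsilon> \<longrightarrow> f (dist (g x) (g u)) \<le> k * dist x u"
    and L: "k < L" "\<forall>\<^sub>F t in at_right 0. L * t \<le> f t"
    and "complete (UNIV :: 'a set)" "rectifiably_path_connected (UNIV :: 'a set)"
  shows "\<exists>x0. g x0 = x0 \<and> (\<forall>z. g z = z \<longrightarrow> z = x0) \<and> (\<forall>x. (\<lambda>n. (g ^^ n) x) \<longlonglongrightarrow> x0)"
proof (rule locally_radially_lipschitz_fixed_point)
  show "locally_radially_lipschitz (k / L) g"
    using assms by (intro metric_preserving_locally_radially_lipschitz) auto
qed (use assms in auto)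

section \<open>Lower slopes from the two hypotheses at 0\<close>

text \<open>A real \<open>L\<close> strictly between \<open>k\<close> and the derivative exists even
  when the derivative is \<infinity>. Since the derivative is a genuine limit, the difference
  quotients eventually exceed \<open>L\<close>.\<close>

lemma metric_preserving_linear_lower_bound_right_deriv:
  assumes f: "metric_preserving f" and "ereal k < right_deriv_0 f"
  obtains L where "k < L" "\<forall>\<^sub>F t in at_right 0. L * t \<le> f t"
proof -
  obtain L where L: "k < L" "ereal L < right_deriv_0 f"
    using ereal_dense2[OF assms(2)] by auto
  have "\<forall>\<^sub>F t in at_right 0. ereal L < ereal ((f t - f 0) / t)"
    using metric_preserving_right_deriv_0[OF f] L(2) by (rule order_tendstoD)
  moreover have "\<forall>\<^sub>F t in at_right (0::real). 0 < t"
    by (rule eventually_at_right_less)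
  ultimately have "\<forall>\<^sub>F t in at_right 0. L * t \<le> f t"
    by eventually_elim (simp add: metric_preserving_0[OF f] field_simps)
  with L(1) that show ?thesis by blast
qed

lemma eventually_at_right_0_rescale:
  fixes c :: real
  assumes "0 < c" and "\<forall>\<^sub>F t in at_right 0. k * t \<le> f (c * t)"
  shows "\<forall>\<^sub>F t in at_right 0. k / c * t \<le> f t"
proof -
  obtain \<delta> where \<delta>: "\<delta> > 0" "\<And>t. 0 < t \<Longrightarrow> t < \<delta> \<Longrightarrow> k * t \<le> f (c * t)"
    using assms(2) unfolding eventually_at_right_field by auto
  \<comment> \<open>The hypothesis is used at \<open>t / c\<close>, which lies below
    \<open>\<delta>\<close> exactly when \<open>t < c * \<delta>\<close>.\<close>
  have "k / c * t \<le> f t" if "0 < t" "t < c * \<delta>" for t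
    using \<delta>(2)[of "t / c"] that \<open>0 < c\<close> by (simp add: field_simps)
  moreover have "c * \<delta> > 0"
    using \<open>0 < c\<close> \<delta>(1) by simp
  ultimately show ?thesis
    unfolding eventually_at_right_field by (metis)
qed

theorem theorem25:
  fixes g :: "'a::metric_space \<Rightarrow> 'a"
  shows
    "((\<exists>k f. 0 < k \<and> k < 1 \<and> metric_preserving f \<and>
         (\<forall>x. \<exists>\<epsilon>>0. \<forall>u. dist x u < \<epsilon> \<longrightarrow> f (dist (g x) (g u)) \<le> k * dist x u) \<and>
         right_deriv_0 f > ereal k) \<and>
      complete (UNIV :: 'a set) \<and> rectifiably_path_connected (UNIV :: 'a set)
      \<longrightarrow> (\<exists>x0. g x0 = x0 \<and> (\<forall>z. g z = z \<longrightarrow> z = x0) \<and>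
             (\<forall>x. (\<lambda>n. (g ^^ n) x) \<longlonglongrightarrow> x0)))
     \<and>
     ((\<exists>k f. 0 < k \<and> k < 1 \<and> metric_preserving f \<and>
         (\<forall>x. \<exists>\<epsilon>>0. \<forall>u. dist x u < \<epsilon> \<longrightarrow> f (dist (g x) (g u)) \<le> k * dist x u) \<and>
         (\<exists>c. 0 < c \<and> c < 1 \<and> (\<forall>\<^sub>F t in at_right 0. f (c * t) \<ge> k * t))) \<and>
      complete (UNIV :: 'a set) \<and> rectifiably_path_connected (UNIV :: 'a set)
      \<longrightarrow> (\<exists>x0. g x0 = x0 \<and> (\<forall>z. g z = z \<longrightarrow> z = x0) \<and>
             (\<forall>x. (\<lambda>n. (g ^^ n) x) \<longlonglongrightarrow> x0)))"
proof (intro conjI impI; elim conjE exE)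
  fix k f
  assume *: "0 < k" "metric_preserving f" "ereal k < right_deriv_0 f"
    "\<forall>x. \<exists>\<epsilon>>0. \<forall>u. dist x u < \<epsilon> \<longrightarrow> f (dist (g x) (g u)) \<le> k * dist x u"
    "complete (UNIV :: 'a set)" "rectifiably_path_connected (UNIV :: 'a set)"
  obtain L where "k < L" "\<forall>\<^sub>F t in at_right 0. L * t \<le> f t"
    using metric_preserving_linear_lower_bound_right_deriv[OF *(2,3)] .
  with * show "\<exists>x0. g x0 = x0 \<and> (\<forall>z. g z = z \<longrightarrow> z = x0) \<and> (\<forall>x. (\<lambda>n. (g ^^ n) x) \<longlonglongrightarrow> x0)"
    by (intro metric_preserving_contraction_fixed_point)
next
  fix k f c
  assume *: "0 < k" "metric_preserving f" "0 < c" "c < 1"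
    "\<forall>\<^sub>F t in at_right 0. k * t \<le> f (c * t)"
    "\<forall>x. \<exists>\<epsilon>>0. \<forall>u. dist x u < \<epsilon> \<longrightarrow> f (dist (g x) (g u)) \<le> k * dist x u"
    "complete (UNIV :: 'a set)" "rectifiably_path_connected (UNIV :: 'a set)"
  \<comment> \<open>Here \<open>c < 1\<close> enters: the slope \<open>k / c\<close> obtained by
    rescaling serves as \<open>L\<close>.\<close>
  have "k < k / c"
    using * by (simp add: field_simps)
  with * eventually_at_right_0_rescale[OF *(3,5)]
  show "\<exists>x0. g x0 = x0 \<and> (\<forall>z. g z = z \<longrightarrow> z = x0) \<and> (\<forall>x. (\<lambda>n. (g ^^ n) x) \<longlonglongrightarrow> x0)"
    by (intro metric_preserving_contraction_fixed_point)
qed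

end
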